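(* Let $\sigma=\{\pi_i \mid i\in I\}$ be a partition of the set of all primes into mutually disjoint subsets, let $G$ be a finite group and let $H$ be a $\sigma^{(3)}$-permutable subgroup of $G$. Then $H$ is $\sigma$-subnormal in $G$.
   Context: All groups are finite. $\sigma=\{\pi_i \mid i\in I\}$ is a partition of the set $\mathbb{P}$ of all primes: $\pi_i\cap\pi_j=\emptyset$ for $i\neq j$ and $\bigcup_{i\in I}\pi_i=\mathbb{P}$. We write $P^x=x^{-1}Px$. For a group $X$, $\pi(X)$ is the set of primes dividing $|X|$; for $K\le X$, $K_X$ denotes the largest normal subgroup of $X$ contained in $K$. For a set of primes $\pi$, $\mathfrak{G}_\pi$ denotes the class of all finite $\pi$-groups. A subgroup $P$ of $G$ is a $\mathfrak{G}_\pi$-projector of $G$ if, for every normal subgroup $N$ of $G$, $PN/N$ is $\mathfrak{G}_\pi$-maximal in $G/N$, i.e. $PN/N$ is a $\pi$-subgroup of $G/N$ not properly contained in any other $\pi$-subgroup of $G/N$. (Such projectors exist in every finite group.) A subgroup $H$ of $G$ is called $\sigma^{(3)}$-permutable if for every $\pi_i\in\sigma$ there is a $\mathfrak{G}_{\pi_i}$-projector $P$ of $G$ such that $HP^x=P^xH$ for all $x\in G$. A subgroup $H$ of $G$ is called $\sigma$-subnormal in $G$ if there is a chain of subgroups $H=H_0\leq H_1\leq\dots\leq H_n=G$ such that for each $j=1,\dots,n$ either $H_{j-1}$ is normal in $H_j$ or $\pi\big(H_j/(H_{j-1})_{H_j}\big)\subseteq\pi_i$ for some $\pi_i\in\sigma$.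 *)

theory Defs
  imports "HOL-Algebra.Coset" "HOL-Library.Disjoint_Sets" "HOL-Computational_Algebra.Primes"
begin

definition prime_partition :: "'i set \<Rightarrow> ('i \<Rightarrow> nat set) \<Rightarrow> bool"
  where "prime_partition I \<pi> \<longleftrightarrow>
    disjoint_family_on \<pi> I \<and> (\<Union>i\<in>I. \<pi> i) = {p. Factorial_Ring.prime p}"

definition group_primes :: "('a, 'b) monoid_scheme \<Rightarrow> nat set"
  where "group_primes G = {p. Factorial_Ring.prime p \<and> p dvd Coset.order G}"

definition pi_group :: "nat set \<Rightarrow> ('a, 'b) monoid_scheme \<Rightarrow> bool"
  where "pi_group \<pi> G \<longleftrightarrow> Group.group G \<and> finite (carrier G) \<and> group_primes G \<subseteq> \<pi>"

definition pi_subgroup :: "nat set \<Rightarrow> ('a, 'b) monoid_scheme \<Rightarrow> 'a set \<Rightarrow> bool"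
  where "pi_subgroup \<pi> G K \<longleftrightarrow> subgroup K G \<and> pi_group \<pi> (G\<lparr>carrier := K\<rparr>)"

definition pi_maximal :: "nat set \<Rightarrow> ('a, 'b) monoid_scheme \<Rightarrow> 'a set \<Rightarrow> bool"
  where "pi_maximal \<pi> G K \<longleftrightarrow>
    pi_subgroup \<pi> G K \<and> (\<forall>L. pi_subgroup \<pi> G L \<and> K \<subseteq> L \<longrightarrow> L = K)"

text \<open>In the following definition, the carrier of
  \<open>G\<lparr>carrier := P <#>\<^bsub>G\<^esub> N\<rparr> Mod N\<close> is the set of cosets \<open>PN/N\<close>, a subset of the
  carrier of \<open>G Mod N\<close>.\<close>

definition pi_projector :: "nat set \<Rightarrow> ('a, 'b) monoid_scheme \<Rightarrow> 'a set \<Rightarrow> bool"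
  where "pi_projector \<pi> G P \<longleftrightarrow>
    subgroup P G \<and>
    (\<forall>N. N \<lhd> G \<longrightarrow>
      pi_maximal \<pi> (G Mod N) (carrier (G\<lparr>carrier := P <#>\<^bsub>G\<^esub> N\<rparr> Mod N)))"

definition conjugate_set :: "('a, 'b) monoid_scheme \<Rightarrow> 'a set \<Rightarrow> 'a \<Rightarrow> 'a set"
  where "conjugate_set G P x = inv\<^bsub>G\<^esub> x <#\<^bsub>G\<^esub> (P #>\<^bsub>G\<^esub> x)"

definition sigma3_permutable :: "nat set set \<Rightarrow> ('a, 'b) monoid_scheme \<Rightarrow> 'a set \<Rightarrow> bool"
  where "sigma3_permutable \<sigma> G H \<longleftrightarrow>
    subgroup H G \<and>
    (\<forall>\<pi>\<in>\<sigma>. \<exists>P. pi_projector \<pi> G P \<and>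
      (\<forall>x\<in>carrier G.
        H <#>\<^bsub>G\<^esub> conjugate_set G P x = conjugate_set G P x <#>\<^bsub>G\<^esub> H))"

definition normal_core :: "('a, 'b) monoid_scheme \<Rightarrow> 'a set \<Rightarrow> 'a set"
  where "normal_core G K = (GREATEST L. L \<lhd> G \<and> L \<subseteq> K)"

text \<open>The largest normal subgroup contained in a given subgroup exists, so
  \<^const>\<open>normal_core\<close> is well defined on subgroups.\<close>

lemma normal_core_greatest:
  fixes G (structure)
  assumes "Group.group G" and "subgroup K G"
  shows "normal_core G K \<lhd> G" and "normal_core G K \<subseteq> K"
    and "\<And>L. L \<lhd> G \<Longrightarrow> L \<subseteq> K \<Longrightarrow> L \<subseteq> normal_core G K"
proof -
  interpret group G by fact
  interpret K: subgroup K G by fact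
  define C where "C = {k \<in> K. \<forall>x\<in>carrier G. x \<otimes> k \<otimes> inv x \<in> K}"
  have sub: "subgroup C G"
  proof (rule subgroupI)
    show "C \<subseteq> carrier G" using K.subset by (auto simp: C_def)
    have "\<one> \<in> C" by (auto simp: C_def)
    then show "C \<noteq> {}" by blast
  next
    fix a assume a: "a \<in> C"
    have ac: "a \<in> carrier G" using a K.subset by (auto simp: C_def)
    have "x \<otimes> inv a \<otimes> inv x \<in> K" if x: "x \<in> carrier G" for x
    proof -
      have "x \<otimes> inv a \<otimes> inv x = inv (x \<otimes> a \<otimes> inv x)"
        using x ac by (simp add: inv_mult_group m_assoc)
      then show ?thesis using a x by (auto simp: C_def)
    qed
    then show "inv a \<in> C" using a by (auto simp: C_def)
  next
    fix a b assume a: "a \<in> C" and b: "b \<in> C"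
    have ac: "a \<in> carrier G" "b \<in> carrier G" using a b K.subset by (auto simp: C_def)
    have "x \<otimes> (a \<otimes> b) \<otimes> inv x \<in> K" if x: "x \<in> carrier G" for x
    proof -
      have "x \<otimes> (a \<otimes> b) \<otimes> inv x = (x \<otimes> a \<otimes> inv x) \<otimes> (x \<otimes> b \<otimes> inv x)"
        using x ac by (simp add: m_assoc inv_solve_left)
      then show ?thesis using a b x by (auto simp: C_def)
    qed
    then show "a \<otimes> b \<in> C" using a b by (auto simp: C_def)
  qed
  have "x \<otimes> h \<otimes> inv x \<in> C" if x: "x \<in> carrier G" and h: "h \<in> C" for x h
  proof -
    have hc: "h \<in> carrier G" using h K.subset by (auto simp: C_def)
    have "y \<otimes> (x \<otimes> h \<otimes> inv x) \<otimes> inv y \<in> K" if y: "y \<in> carrier G" for y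
    proof -
      have "y \<otimes> (x \<otimes> h \<otimes> inv x) \<otimes> inv y = (y \<otimes> x) \<otimes> h \<otimes> inv (y \<otimes> x)"
        using x y hc by (simp add: inv_mult_group m_assoc)
      then show ?thesis using h x y by (auto simp: C_def)
    qed
    then show ?thesis using h x by (auto simp: C_def)
  qed
  then have C: "C \<lhd> G \<and> C \<subseteq> K" using sub by (auto simp: normal_inv_iff C_def)
  have max: "L \<subseteq> C" if "L \<lhd> G \<and> L \<subseteq> K" for L
    using that by (auto simp: C_def normal_inv_iff)
  have eq: "normal_core G K = C"
    unfolding normal_core_def by (rule Greatest_equality) (use C max in auto)
  show "normal_core G K \<lhd> G" "normal_core G K \<subseteq> K" using C eq by auto
  show "L \<subseteq> normal_core G K" if "L \<lhd> G" "L \<subseteq> K" for L using that max eq by auto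
qed

definition sigma_subnormal :: "nat set set \<Rightarrow> ('a, 'b) monoid_scheme \<Rightarrow> 'a set \<Rightarrow> bool"
  where "sigma_subnormal \<sigma> G H \<longleftrightarrow>
    (\<exists>n (C :: nat \<Rightarrow> 'a set).
      C 0 = H \<and> C n = carrier G \<and>
      (\<forall>j\<le>n. subgroup (C j) G) \<and>
      (\<forall>j<n. C j \<subseteq> C (Suc j) \<and>
        (C j \<lhd> G\<lparr>carrier := C (Suc j)\<rparr> \<or>
         (\<exists>\<pi>\<in>\<sigma>. group_primes
            (G\<lparr>carrier := C (Suc j)\<rparr> Mod
              normal_core (G\<lparr>carrier := C (Suc j)\<rparr>) (C j)) \<subseteq> \<pi>))))"

end

theory Submission
  imports Defs "HOL-Algebra.Sylow" "HOL-Algebra.Generated_Groups"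
begin

text \<open>
  Choose projectors \<open>P\<^sub>i\<close> as in the hypothesis and let \<open>L\<^sub>i\<close> be the normal closure of \<open>P\<^sub>i\<close>. Two properties
  of projectors carry the proof: \<open>P\<^sub>i\<close> is a \<open>\<pi>\<^sub>i\<close>-group, and \<open>|G : L\<^sub>i|\<close> is a \<open>\<pi>\<^sub>i'\<close>-number, because the
  trivial group \<open>P\<^sub>iL\<^sub>i/L\<^sub>i\<close> is a maximal \<open>\<pi>\<^sub>i\<close>-subgroup of \<open>G/L\<^sub>i\<close>. Call a subgroup permuting if it
  permutes with all conjugates of all \<open>P\<^sub>i\<close>. Joins of conjugates of a permuting subgroup, and its
  products with normal subgroups, are again permuting. By induction, all permuting subgroups
  properly containing \<open>H\<close> may be assumed to be \<open>\<sigma>\<close>-subnormal.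

  If for some \<open>i\<close> all conjugates of all \<open>P\<^sub>j\<close> with \<open>j \<noteq> i\<close> normalize \<open>H\<close>, let \<open>L\<close> be the subgroup that
  they generate. It is normal in \<open>G\<close> and of \<open>\<pi>\<^sub>i\<close>-index, and \<open>H \<lhd> HL\<close>, so \<open>H\<close> is \<open>\<sigma>\<close>-subnormal.

  Otherwise there are indices \<open>i \<noteq> j\<close> and conjugates \<open>P\<close> of \<open>P\<^sub>i\<close> and \<open>Q\<close> of \<open>P\<^sub>j\<close> that do not normalize \<open>H\<close>.
  The join \<open>K\<close> of the conjugates of \<open>H\<close> under \<open>P\<close> is permuting and properly contains \<open>H\<close>, so it is
  \<open>\<sigma>\<close>-subnormal; since \<open>K \<le> HP\<close>, the index of \<open>H\<close> in \<open>K\<close> is a \<open>\<pi>\<^sub>i\<close>-number. For every \<open>k \<noteq> i\<close> and every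
  conjugate \<open>R\<close> of \<open>P\<^sub>k\<close>, comparing indices gives \<open>K \<inter> HR = H\<close>. So \<open>H\<close> is \<open>\<sigma>\<close>-subnormal in \<open>HR\<close> with
  \<open>\<pi>\<^sub>k\<close>-index, which forces the residual of \<open>H\<close> for \<open>\<pi>\<^sub>k\<close> to coincide with that of \<open>HR\<close> and hence to be
  normalized by \<open>R\<close> (lemma \<open>normalizes_pi_residual_of_permutes_with\<close>). The same argument starting
  from \<open>Q\<close> covers the indices \<open>k \<noteq> j\<close>. In particular the residual \<open>A\<close> of \<open>H\<close> for \<open>\<pi>\<^sub>i\<close> is normalized by
  \<open>L\<^sub>i\<close>, and the residual \<open>B\<close> for \<open>\<pi>\<^sub>j\<close> by \<open>L\<^sub>j\<close>. The products \<open>HL\<^sub>i\<close> and \<open>HL\<^sub>j\<close> properly contain \<open>H\<close> and are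
  permuting, hence \<open>\<sigma>\<close>-subnormal. So \<open>B \<lhd> HL\<^sub>j\<close> is \<open>\<sigma>\<close>-subnormal in \<open>G\<close>, therefore in \<open>HL\<^sub>i\<close>, and
  multiplication by \<open>A \<lhd> HL\<^sub>i\<close> shows that \<open>AB\<close> is \<open>\<sigma>\<close>-subnormal in \<open>HL\<^sub>i\<close> and thus in \<open>G\<close>. Finally
  \<open>AB = H\<close>, because the index of \<open>AB\<close> in \<open>H\<close> is both a \<open>\<pi>\<^sub>i\<close>- and a \<open>\<pi>\<^sub>j\<close>-number.
\<close>

section \<open>Indices of subgroups and sets of primes\<close>

definition pi_number :: "nat set \<Rightarrow> nat \<Rightarrow> bool"
  where "pi_number \<pi> n \<longleftrightarrow> (\<forall>p. Factorial_Ring.prime p \<longrightarrow> p dvd n \<longrightarrow> p \<in> \<pi>)"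

text \<open>Indices of subgroups are expressed by factoring cardinalities, so that no cosets are needed.\<close>

definition pi_index :: "nat set \<Rightarrow> 'a set \<Rightarrow> 'a set \<Rightarrow> bool"
  where "pi_index \<pi> A B \<longleftrightarrow> (\<exists>m. card B = card A * m \<and> pi_number \<pi> m)"

lemma pi_number_dvd: "pi_number \<pi> n \<Longrightarrow> m dvd n \<Longrightarrow> pi_number \<pi> m"
  unfolding pi_number_def using dvd_trans by blast

lemma pi_number_disjoint:
  assumes "pi_number \<pi> n" and "pi_number \<rho> n" and "\<pi> \<inter> \<rho> = {}"
  shows "n = 1"
  using assms prime_factor_nat[of n] unfolding pi_number_def by blast

context group
begin

lemma subgroup_finite: "finite (carrier G) \<Longrightarrow> subgroup A G \<Longrightarrow> finite A"
  using finite_subset subgroup.subset by blast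

lemma subgroup_card_pos: "finite (carrier G) \<Longrightarrow> subgroup A G \<Longrightarrow> 0 < card A"
  using subgroup_finite subgroup.one_closed by (fastforce simp: card_gt_0_iff)

lemma subgroup_card_dvd:
  assumes "subgroup A G" and "subgroup B G" and "A \<subseteq> B"
  shows "card A dvd card B"
proof -
  have "subgroup A (G\<lparr>carrier := B\<rparr>)"
    using assms by (intro subgroup_incl)
  then have "card (rcosets\<^bsub>G\<lparr>carrier := B\<rparr>\<^esub> A) * card A = order (G\<lparr>carrier := B\<rparr>)"
    using group.lagrange subgroup_imp_group[OF assms(2)] by blast
  then show ?thesis by (simp add: order_def) (metis dvd_triv_right)
qed

lemma pi_index_between:
  assumes fin: "finite (carrier G)" and A: "subgroup A G" and B: "subgroup B G" and C: "subgroup C G"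
    and "A \<subseteq> C" and "C \<subseteq> B" and ind: "pi_index \<pi> A B"
  shows "pi_index \<pi> A C" and "pi_index \<pi> C B"
proof -
  obtain k where k: "card C = card A * k" using subgroup_card_dvd[OF A C] assms by blast
  obtain l where l: "card B = card C * l" using subgroup_card_dvd[OF C B] assms by blast
  obtain m where m: "card B = card A * m" "pi_number \<pi> m" using ind by (auto simp: pi_index_def)
  have "m = k * l" using k l m subgroup_card_pos[OF fin A] by simp
  then show "pi_index \<pi> A C" "pi_index \<pi> C B"
    using k l m(2) pi_number_dvd[of \<pi> m k] pi_number_dvd[of \<pi> m l] unfolding pi_index_def by auto
qed

lemma pi_index_disjoint:
  assumes fin: "finite (carrier G)" and B: "subgroup B G"
    and sub: "A \<subseteq> B" and "pi_index \<pi> A B" and "pi_index \<rho> A B" and "\<pi> \<inter> \<rho> = {}"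
  shows "A = B"
proof -
  obtain m where m: "card B = card A * m" "pi_number \<pi> m"
    using assms(4) by (auto simp: pi_index_def)
  obtain n where n: "card B = card A * n" "pi_number \<rho> n"
    using assms(5) by (auto simp: pi_index_def)
  have pos: "0 < card B" using subgroup_card_pos[OF fin B] .
  then have "m = n" using m n by auto
  then have "card A = card B" using pi_number_disjoint m n assms(6) by fastforce
  then show ?thesis using card_subset_eq subgroup_finite[OF fin B] sub by blast
qed

lemma card_set_mult_subgroups:
  assumes fin: "finite (carrier G)" and A: "subgroup A G" and B: "subgroup B G"
  shows "card (A <#> B) * card (A \<inter> B) = card A * card B"
proof -
  interpret A: subgroup A G by fact
  interpret B: subgroup B G by fact
  have finA: "finite A" and finB: "finite B" using subgroup_finite fin A B by auto
  define f where "f = (\<lambda>(a, b). a \<otimes> b)"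
  have img: "f ` (A \<times> B) = A <#> B" by (auto simp: f_def set_mult_def)
  have fib: "card {z \<in> A \<times> B. f z = y} = card (A \<inter> B)" if "y \<in> A <#> B" for y
  proof -
    obtain a b where ab: "a \<in> A" "b \<in> B" "y = a \<otimes> b" using \<open>y \<in> A <#> B\<close> by (auto simp: set_mult_def)
    \<comment> \<open>The factorizations of \<open>ab\<close> are \<open>(ad)(d\<^sup>-\<^sup>1b)\<close> with \<open>d \<in> A \<inter> B\<close>.\<close>
    have "bij_betw (\<lambda>d. (a \<otimes> d, inv d \<otimes> b)) (A \<inter> B) {z \<in> A \<times> B. f z = y}"
    proof (rule bij_betwI[where g = "\<lambda>z. inv a \<otimes> fst z"])
      show "(\<lambda>d. (a \<otimes> d, inv d \<otimes> b)) \<in> A \<inter> B \<rightarrow> {z \<in> A \<times> B. f z = y}"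
      proof
        fix d assume d: "d \<in> A \<inter> B"
        have "d \<otimes> (inv d \<otimes> b) = b"
          using d ab by (simp add: m_assoc[symmetric])
        then have "a \<otimes> d \<otimes> (inv d \<otimes> b) = a \<otimes> b"
          using d ab by (simp add: m_assoc)
        then show "(a \<otimes> d, inv d \<otimes> b) \<in> {z \<in> A \<times> B. f z = y}"
          using d ab by (auto simp: f_def)
      qed
      show "(\<lambda>z. inv a \<otimes> fst z) \<in> {z \<in> A \<times> B. f z = y} \<rightarrow> A \<inter> B"
      proof
        fix z assume "z \<in> {z \<in> A \<times> B. f z = y}"
        then obtain c e where z: "z = (c, e)" "c \<in> A" "e \<in> B" "c \<otimes> e = a \<otimes> b"
          using ab by (auto simp: f_def)
        have "c = a \<otimes> b \<otimes> inv e"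
          using z ab by (intro inv_solve_right[THEN iffD2]) auto
        then have "inv a \<otimes> c = b \<otimes> inv e"
          using z ab by (simp add: m_assoc[symmetric])
        then have "inv a \<otimes> c \<in> B" using z ab by simp
        then show "inv a \<otimes> fst z \<in> A \<inter> B" using z ab by simp
      qed
      show "inv a \<otimes> fst (a \<otimes> d, inv d \<otimes> b) = d" if "d \<in> A \<inter> B" for d
        using that ab by (simp add: m_assoc[symmetric])
      show "(a \<otimes> (inv a \<otimes> fst z), inv (inv a \<otimes> fst z) \<otimes> b) = z"
        if zf: "z \<in> {z \<in> A \<times> B. f z = y}" for z
      proof -
        obtain c e where z: "z = (c, e)" "c \<in> A" "e \<in> B" "c \<otimes> e = a \<otimes> b"
          using zf ab by (auto simp: f_def)
        have "inv c \<otimes> (a \<otimes> b) = e" using z(4)[symmetric] z(2,3) by (simp add: m_assoc[symmetric])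
        then show ?thesis using z ab
          by (simp add: m_assoc[symmetric] inv_mult_group) 
      qed
    qed
    then show ?thesis using bij_betw_same_card by fastforce
  qed
  have "card A * card B = card (A \<times> B)" by (simp add: card_cartesian_product)
  also have "\<dots> = (\<Sum>y\<in>f ` (A \<times> B). card {z \<in> A \<times> B. f z = y})"
    using sum.image_gen[of "A \<times> B" "\<lambda>_. 1::nat" f] finA finB by simp
  also have "\<dots> = (\<Sum>y\<in>A <#> B. card (A \<inter> B))" using img fib by simp
  finally show ?thesis by simp
qed

text \<open>This lemma and the next one say that \<open>|AB : A| = |B : A \<inter> B|\<close>, also when \<open>AB\<close> is not a
  subgroup.\<close>

lemma pi_index_set_mult:
  assumes fin: "finite (carrier G)" and A: "subgroup A G" and B: "subgroup B G" 
    and ind: "pi_index \<pi> (A \<inter> B) B"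
  shows "pi_index \<pi> A (A <#> B)"
proof -
  obtain m where m: "card B = card (A \<inter> B) * m" "pi_number \<pi> m" using ind by (auto simp: pi_index_def)
  have "0 < card (A \<inter> B)" using subgroup_card_pos[OF fin subgroups_Inter_pair[OF A B]] .
  then have "card (A <#> B) = card A * m" using card_set_mult_subgroups[OF fin A B] m by simp
  then show ?thesis using m unfolding pi_index_def by blast
qed

lemma pi_index_Int:
  assumes fin: "finite (carrier G)" and A: "subgroup A G" and B: "subgroup B G" 
    and ind: "pi_index \<pi> A (A <#> B)"
  shows "pi_index \<pi> (A \<inter> B) B"
proof -
  obtain m where m: "card (A <#> B) = card A * m" "pi_number \<pi> m" using ind by (auto simp: pi_index_def)
  have "card B = card (A \<inter> B) * m" using card_set_mult_subgroups[OF fin A B] m subgroup_card_pos[OF fin A]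
    by (simp add: mult.commute mult.left_commute)
  then show ?thesis using m unfolding pi_index_def by blast
qed

section \<open>Normalizing and permuting subgroups\<close>

definition normalizes :: "'a set \<Rightarrow> 'a set \<Rightarrow> bool"
  where "normalizes B A \<longleftrightarrow> (\<forall>b\<in>B. \<forall>a\<in>A. b \<otimes> a \<otimes> inv b \<in> A)"

text \<open>Only the inclusion \<open>AQ \<subseteq> QA\<close> is required. For subgroups, inversion yields the reverse inclusion
  (lemma \<open>permutes_with_sym\<close>), while the elementwise one-sided form passes easily to generated
  subgroups.\<close>

definition permutes_with :: "'a set \<Rightarrow> 'a set \<Rightarrow> bool"
  where "permutes_with A Q \<longleftrightarrow> (\<forall>a\<in>A. \<forall>q\<in>Q. \<exists>q'\<in>Q. \<exists>a'\<in>A. a \<otimes> q = q' \<otimes> a')"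

definition conjugate :: "'a \<Rightarrow> 'a set \<Rightarrow> 'a set"
  where "conjugate g A = (\<lambda>a. g \<otimes> a \<otimes> inv g) ` A"

lemma inv_mult_cancel:
  assumes "g \<in> carrier G" and "z \<in> carrier G"
  shows "inv g \<otimes> (g \<otimes> z) = z"
  using assms by (simp add: m_assoc[symmetric])

lemma normalizes_subset: "normalizes B A \<Longrightarrow> C \<subseteq> B \<Longrightarrow> normalizes C A"
  unfolding normalizes_def by blast

lemma normalizes_self: "subgroup A G \<Longrightarrow> normalizes A A"
  by (simp add: normalizes_def subgroup.m_closed subgroup.m_inv_closed)

lemma normalizes_Int: "subgroup X G \<Longrightarrow> normalizes B A \<Longrightarrow> normalizes (B \<inter> X) (A \<inter> X)"
  by (simp add: normalizes_def subgroup.m_closed subgroup.m_inv_closed)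

lemma normalizes_set_mult:
  assumes "normalizes B A" and "normalizes C A" and "A \<subseteq> carrier G" and "B \<subseteq> carrier G" and "C \<subseteq> carrier G"
  shows "normalizes (B <#> C) A"
  unfolding normalizes_def set_mult_def
proof clarsimp
  fix b c a assume x: "b \<in> B" "c \<in> C" "a \<in> A"
  then have "b \<otimes> c \<otimes> a \<otimes> inv (b \<otimes> c) = b \<otimes> (c \<otimes> a \<otimes> inv c) \<otimes> inv b"
    using assms(3-5) by (simp add: subset_iff inv_mult_group m_assoc)
  then show "b \<otimes> c \<otimes> a \<otimes> inv (b \<otimes> c) \<in> A"
    using x assms(1,2) by (simp add: normalizes_def)
qed

lemma normalizes_generate:
  assumes A: "A \<subseteq> carrier G" and S: "\<And>S. S \<in> \<S> \<Longrightarrow> subgroup S G" "\<And>S. S \<in> \<S> \<Longrightarrow> normalizes S A"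
  shows "normalizes (generate G (\<Union>\<S>)) A"
proof -
  have sub: "\<Union>\<S> \<subseteq> carrier G" using S(1) subgroup.subset by blast
  have "\<forall>a\<in>A. g \<otimes> a \<otimes> inv g \<in> A" if "g \<in> generate G (\<Union>\<S>)" for g
    using that
  proof (induction rule: generate.induct)
    case one
    then show ?case using A by auto
  next
    case (incl h)
    then show ?case using S(2) by (auto simp: normalizes_def)
  next
    case (inv h)
    then obtain S where T: "S \<in> \<S>" "h \<in> S" by auto
    then have "inv h \<in> S" using S(1) subgroup.m_inv_closed by metis
    then show ?case using S(2)[OF T(1)] by (auto simp: normalizes_def)
  next
    case (eng g h)
    have "g \<otimes> h \<otimes> a \<otimes> inv (g \<otimes> h) = g \<otimes> (h \<otimes> a \<otimes> inv h) \<otimes> inv g" if "a \<in> A" for a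
      using that A eng.hyps[THEN generate_in_carrier[OF sub]]
      by (simp add: subset_iff inv_mult_group m_assoc)
    then show ?case using eng.IH by simp
  qed
  then show ?thesis by (simp add: normalizes_def)
qed

lemma permutes_with_sym:
  assumes A: "subgroup A G" and Q: "subgroup Q G" and "permutes_with A Q"
  shows "permutes_with Q A"
  unfolding permutes_with_def
proof (intro ballI)
  fix q a assume qa: "q \<in> Q" "a \<in> A"
  then obtain q' a' where e: "q' \<in> Q" "a' \<in> A" "inv a \<otimes> inv q = q' \<otimes> a'"
    using assms subgroup.m_inv_closed unfolding permutes_with_def by metis
  have "q \<otimes> a = inv (inv a \<otimes> inv q)"
    using qa A Q by (simp add: inv_mult_group subgroup.mem_carrier)
  also have "\<dots> = inv a' \<otimes> inv q'"
    unfolding e(3) using e(1,2) A Q by (simp add: inv_mult_group subgroup.mem_carrier)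
  finally have "q \<otimes> a = inv a' \<otimes> inv q'" .
  then show "\<exists>b\<in>A. \<exists>r\<in>Q. q \<otimes> a = b \<otimes> r" using e A Q subgroup.m_inv_closed by metis
qed

lemma subgroup_set_mult:
  assumes A: "subgroup A G" and Q: "subgroup Q G" and p: "permutes_with A Q"
  shows "subgroup (A <#> Q) G"
proof (rule subgroupI)
  interpret A: subgroup A G by fact
  interpret Q: subgroup Q G by fact
  note p' = permutes_with_sym[OF assms]
  show "A <#> Q \<subseteq> carrier G" by (auto simp: set_mult_def)
  show "A <#> Q \<noteq> {}" using A.one_closed Q.one_closed unfolding set_mult_def by blast
  show "inv x \<in> A <#> Q" if x: "x \<in> A <#> Q" for x
  proof -
    obtain a q where aq: "a \<in> A" "q \<in> Q" "x = a \<otimes> q" using x by (auto simp: set_mult_def)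
    obtain a' q' where "a' \<in> A" "q' \<in> Q" "inv q \<otimes> inv a = a' \<otimes> q'"
      using p' aq unfolding permutes_with_def by (metis A.m_inv_closed Q.m_inv_closed)
    then show ?thesis using aq by (auto simp: set_mult_def inv_mult_group)
  qed
  show "x \<otimes> y \<in> A <#> Q" if x: "x \<in> A <#> Q" and y: "y \<in> A <#> Q" for x y
  proof -
    obtain a q where aq: "a \<in> A" "q \<in> Q" "x = a \<otimes> q" using x by (auto simp: set_mult_def)
    obtain b r where br: "b \<in> A" "r \<in> Q" "y = b \<otimes> r" using y by (auto simp: set_mult_def)
    obtain c s where cs: "c \<in> A" "s \<in> Q" "q \<otimes> b = c \<otimes> s"
      using p' aq br unfolding permutes_with_def by metis
    have "x \<otimes> y = a \<otimes> (q \<otimes> b) \<otimes> r" using aq br by (simp add: m_assoc)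
    also have "\<dots> = (a \<otimes> c) \<otimes> (s \<otimes> r)" using aq br cs by (simp add: m_assoc)
    finally show ?thesis using aq br cs by (auto simp: set_mult_def)
  qed
qed

lemma normalizes_imp_permutes_with:
  assumes A: "subgroup A G" and B: "subgroup B G" and n: "normalizes B A"
  shows "permutes_with A B"
  unfolding permutes_with_def
proof (intro ballI)
  fix a b assume ab: "a \<in> A" "b \<in> B"
  interpret A: subgroup A G by fact
  interpret B: subgroup B G by fact
  have "inv b \<otimes> a \<otimes> inv (inv b) \<in> A" using n ab unfolding normalizes_def by blast
  moreover have "a \<otimes> b = b \<otimes> (inv b \<otimes> a \<otimes> inv (inv b))" using ab by (simp add: m_assoc[symmetric])
  ultimately show "\<exists>b'\<in>B. \<exists>a'\<in>A. a \<otimes> b = b' \<otimes> a'" using ab by blast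
qed

lemma subset_set_mult_left: "A \<subseteq> carrier G \<Longrightarrow> subgroup Q G \<Longrightarrow> A \<subseteq> A <#> Q"
  unfolding set_mult_def using subgroup.one_closed by force

lemma subset_set_mult_right: "Q \<subseteq> carrier G \<Longrightarrow> subgroup A G \<Longrightarrow> Q \<subseteq> A <#> Q"
  unfolding set_mult_def using subgroup.one_closed by force

lemma set_mult_subset_subgroup: "subgroup C G \<Longrightarrow> A \<subseteq> C \<Longrightarrow> B \<subseteq> C \<Longrightarrow> A <#> B \<subseteq> C"
  unfolding set_mult_def using subgroup.m_closed by fast

lemma permutes_with_generate:
  assumes Q: "subgroup Q G" and S: "\<And>A. A \<in> \<A> \<Longrightarrow> subgroup A G" "\<And>A. A \<in> \<A> \<Longrightarrow> permutes_with A Q"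
  shows "permutes_with (generate G (\<Union>\<A>)) Q"
proof -
  have sub: "\<Union>\<A> \<subseteq> carrier G" using S(1) subgroup.subset by blast
  have Qc: "Q \<subseteq> carrier G" using Q subgroup.subset by blast
  let ?K = "generate G (\<Union>\<A>)"
  have *: "\<exists>q'\<in>Q. \<exists>a'\<in>?K. a \<otimes> q = q' \<otimes> a'" if "A \<in> \<A>" "a \<in> A" "q \<in> Q" for A a q
    using S(2)[OF that(1)] that generate.incl[of _ "\<Union>\<A>" G] unfolding permutes_with_def by blast
  have "\<forall>q\<in>Q. \<exists>q'\<in>Q. \<exists>a'\<in>?K. g \<otimes> q = q' \<otimes> a'" if "g \<in> ?K" for g
    using that
  proof (induction rule: generate.induct)
    case one
    show ?case
    proof
      fix q assume "q \<in> Q"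
      then have "\<one> \<otimes> q = q \<otimes> \<one>" using Qc by auto
      then show "\<exists>q'\<in>Q. \<exists>a'\<in>?K. \<one> \<otimes> q = q' \<otimes> a'" using \<open>q \<in> Q\<close> generate.one by blast
    qed
  next
    case (incl h)
    then show ?case using * by blast
  next
    case (inv h)
    then obtain A where A: "A \<in> \<A>" "h \<in> A" by auto
    then have "inv h \<in> A" using S(1) subgroup.m_inv_closed by metis
    then show ?case using * A by blast
  next
    case (eng g h)
    show ?case
    proof
      fix q assume q: "q \<in> Q"
      obtain r k where r: "r \<in> Q" "k \<in> ?K" "h \<otimes> q = r \<otimes> k" using eng.IH(2) q by blast
      obtain s l where s: "s \<in> Q" "l \<in> ?K" "g \<otimes> r = s \<otimes> l" using eng.IH(1) r(1) by blast
      note c = eng.hyps[THEN generate_in_carrier[OF sub]] r(2)[THEN generate_in_carrier[OF sub]]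
        s(2)[THEN generate_in_carrier[OF sub]]
      have "g \<otimes> h \<otimes> q = g \<otimes> (h \<otimes> q)" using c q Qc by (auto simp: m_assoc)
      also have "\<dots> = g \<otimes> r \<otimes> k" using r c Qc by (auto simp: m_assoc)
      also have "\<dots> = s \<otimes> (l \<otimes> k)" using s c Qc by (auto simp: m_assoc)
      finally show "\<exists>q'\<in>Q. \<exists>a'\<in>?K. g \<otimes> h \<otimes> q = q' \<otimes> a'"
        using s r generate.eng by metis
    qed
  qed
  then show ?thesis by (simp add: permutes_with_def)
qed

lemma conjugate_subgroup:
  assumes g: "g \<in> carrier G" and A: "subgroup A G"
  shows "subgroup (conjugate g A) G"
proof (rule subgroupI)
  interpret A: subgroup A G by fact
  show "conjugate g A \<subseteq> carrier G" using g by (auto simp: conjugate_def)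
  show "conjugate g A \<noteq> {}" using A.one_closed unfolding conjugate_def by blast
  fix x assume "x \<in> conjugate g A"
  then obtain a where a: "a \<in> A" "x = g \<otimes> a \<otimes> inv g" by (auto simp: conjugate_def)
  have "inv x = g \<otimes> inv a \<otimes> inv g" using g a by (simp add: inv_mult_group m_assoc)
  then show "inv x \<in> conjugate g A" using a by (auto simp: conjugate_def)
  fix y assume "y \<in> conjugate g A"
  then obtain b where b: "b \<in> A" "y = g \<otimes> b \<otimes> inv g" by (auto simp: conjugate_def)
  have "x \<otimes> y = g \<otimes> (a \<otimes> b) \<otimes> inv g" using g a b by (simp add: m_assoc inv_mult_cancel)
  then show "x \<otimes> y \<in> conjugate g A" using a b by (auto simp: conjugate_def)
qed

lemma conjugate_conjugate:
  assumes "g \<in> carrier G" "h \<in> carrier G" "A \<subseteq> carrier G"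
  shows "conjugate g (conjugate h A) = conjugate (g \<otimes> h) A"
  using assms unfolding conjugate_def image_image
  by (intro image_cong) (auto simp: inv_mult_group m_assoc subset_iff)

lemma card_conjugate:
  assumes "g \<in> carrier G" "A \<subseteq> carrier G"
  shows "card (conjugate g A) = card A"
  unfolding conjugate_def
  using assms by (intro card_image inj_onI) (auto simp: subset_iff)

lemma permutes_with_conjugate:
  assumes g: "g \<in> carrier G" and H: "subgroup H G" and Q: "subgroup Q G"
    and p: "permutes_with H (conjugate (inv g) Q)"
  shows "permutes_with (conjugate g H) Q"
  unfolding permutes_with_def
proof (intro ballI)
  interpret H: subgroup H G by fact
  interpret Q: subgroup Q G by fact
  fix x q assume "x \<in> conjugate g H" and q: "q \<in> Q"
  then obtain h where h: "h \<in> H" "x = g \<otimes> h \<otimes> inv g" by (auto simp: conjugate_def)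
  have "inv g \<otimes> q \<otimes> inv (inv g) \<in> conjugate (inv g) Q" using q by (auto simp: conjugate_def)
  then obtain q' h' where q': "q' \<in> Q" "h' \<in> H"
      "h \<otimes> (inv g \<otimes> q \<otimes> inv (inv g)) = (inv g \<otimes> q' \<otimes> inv (inv g)) \<otimes> h'"
    using p h unfolding permutes_with_def conjugate_def by blast
  have "x \<otimes> q = g \<otimes> (h \<otimes> (inv g \<otimes> q \<otimes> inv (inv g))) \<otimes> inv g"
    using h q g by (simp add: m_assoc)
  also have "\<dots> = q' \<otimes> (g \<otimes> h' \<otimes> inv g)"
    unfolding q'(3) using q' g by (simp add: m_assoc[symmetric])
  finally show "\<exists>q'\<in>Q. \<exists>a'\<in>conjugate g H. x \<otimes> q = q' \<otimes> a'"
    using q' by (auto simp: conjugate_def)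
qed

lemma permutes_with_set_mult_normal:
  assumes H: "subgroup H G" and Q: "subgroup Q G" and L: "subgroup L G"
    and p: "permutes_with H Q" and n: "normalizes (carrier G) L"
  shows "permutes_with (H <#> L) Q"
  unfolding permutes_with_def
proof (intro ballI)
  interpret H: subgroup H G by fact
  interpret Q: subgroup Q G by fact
  interpret L: subgroup L G by fact
  fix x q assume "x \<in> H <#> L" and q: "q \<in> Q"
  then obtain h l where hl: "h \<in> H" "l \<in> L" "x = h \<otimes> l" by (auto simp: set_mult_def)
  have "permutes_with L Q"
    using normalizes_imp_permutes_with[OF L Q] normalizes_subset[OF n Q.subset] by blast
  then obtain r m where r: "r \<in> Q" "m \<in> L" "l \<otimes> q = r \<otimes> m"
    using hl q unfolding permutes_with_def by blast
  obtain s k where s: "s \<in> Q" "k \<in> H" "h \<otimes> r = s \<otimes> k"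
    using p hl r unfolding permutes_with_def by blast
  have "x \<otimes> q = h \<otimes> (l \<otimes> q)" using hl q by (simp add: m_assoc)
  also have "\<dots> = h \<otimes> r \<otimes> m" using hl r by (simp add: m_assoc)
  also have "\<dots> = s \<otimes> (k \<otimes> m)" using r s by (simp add: m_assoc)
  finally show "\<exists>q'\<in>Q. \<exists>a'\<in>H <#> L. x \<otimes> q = q' \<otimes> a'"
    using s r by (auto simp: set_mult_def)
qed

section \<open>Chains of subgroups\<close>

text \<open>One link of a \<open>\<sigma>\<close>-subnormal chain, with the core replaced by an arbitrary normal subgroup \<open>N\<close> of
  \<open>B\<close> inside \<open>A\<close>: this is equivalent, because a larger \<open>N\<close> has smaller index, and it makes the
  stability properties below easy to verify.\<close>

definition sigma_step :: "nat set set \<Rightarrow> 'a set \<Rightarrow> 'a set \<Rightarrow> bool"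
  where "sigma_step \<sigma> A B \<longleftrightarrow> subgroup A G \<and> subgroup B G \<and> A \<subseteq> B \<and>
    (normalizes B A \<or>
     (\<exists>\<pi>\<in>\<sigma>. \<exists>N. subgroup N G \<and> N \<subseteq> A \<and> normalizes B N \<and> pi_index \<pi> N B))"

abbreviation sigma_sn :: "nat set set \<Rightarrow> 'a set \<Rightarrow> 'a set \<Rightarrow> bool"
  where "sigma_sn \<sigma> \<equiv> (sigma_step \<sigma>)\<^sup>*\<^sup>*"

text \<open>For finite \<open>A\<close>, the classical \<open>O\<^sup>\<pi>(A)\<close>, the smallest normal subgroup of \<open>A\<close> with a \<open>\<pi>\<close>-group as quotient,
  described through its generators. In this form it depends only on the set of \<open>\<pi>'\<close>-subgroups of
  \<open>A\<close>, which is what makes residuals of different subgroups comparable.\<close>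

definition pi_residual :: "nat set \<Rightarrow> 'a set \<Rightarrow> 'a set"
  where "pi_residual \<pi> A = generate G (\<Union>{Q. subgroup Q G \<and> Q \<subseteq> A \<and> pi_number (- \<pi>) (card Q)})"

lemma sigma_sn_subset: "sigma_sn \<sigma> A B \<Longrightarrow> A \<subseteq> B"
  by (induction rule: rtranclp_induct) (auto simp: sigma_step_def)

text \<open>Intersecting with \<open>X\<close> preserves a step, since \<open>(B \<inter> X) / (N \<inter> X)\<close> embeds into \<open>B / N\<close>.\<close>

lemma sigma_step_Int:
  assumes fin: "finite (carrier G)" and X: "subgroup X G" and st: "sigma_step \<sigma> A B"
  shows "sigma_step \<sigma> (A \<inter> X) (B \<inter> X)"
proof -
  have A: "subgroup A G" and B: "subgroup B G" and AB: "A \<subseteq> B"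
    using st by (auto simp: sigma_step_def)
  have BX: "subgroup (B \<inter> X) G" and AX: "subgroup (A \<inter> X) G"
    using subgroups_Inter_pair A B X by auto
  consider "normalizes B A"
    | \<pi> N where "\<pi> \<in> \<sigma>" "subgroup N G" "N \<subseteq> A" "normalizes B N" "pi_index \<pi> N B"
    using st by (auto simp: sigma_step_def)
  then show ?thesis
  proof cases
    case 1
    then show ?thesis using normalizes_Int[OF X] AX BX AB by (auto simp: sigma_step_def)
  next
    case 2
    have "permutes_with N (B \<inter> X)"
      using normalizes_imp_permutes_with[OF 2(2) BX] normalizes_subset[OF 2(4)] by blast
    then have S: "subgroup (N <#> (B \<inter> X)) G" by (rule subgroup_set_mult[OF 2(2) BX])
    have "N \<subseteq> N <#> (B \<inter> X)" using subset_set_mult_left BX 2(2) subgroup.subset by blast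
    moreover have "N <#> (B \<inter> X) \<subseteq> B" using set_mult_subset_subgroup[OF B] 2(3) AB by blast
    ultimately have "pi_index \<pi> N (N <#> (B \<inter> X))" using pi_index_between(1)[OF fin 2(2) B S] 2(5) by blast
    then have "pi_index \<pi> (N \<inter> (B \<inter> X)) (B \<inter> X)" by (rule pi_index_Int[OF fin 2(2) BX])
    moreover have "N \<inter> (B \<inter> X) = N \<inter> X" using 2(3) AB by blast
    ultimately show ?thesis
      using normalizes_Int[OF X 2(4)] subgroups_Inter_pair[OF 2(2) X] 2(1,3) AX BX AB
      unfolding sigma_step_def by (metis Int_mono order_refl)
  qed
qed

lemma sigma_sn_Int:
  assumes "finite (carrier G)" and "subgroup X G" and "sigma_sn \<sigma> A B"
  shows "sigma_sn \<sigma> (A \<inter> X) (B \<inter> X)"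
  using assms(3)
proof (induction rule: rtranclp_induct)
  case base
  then show ?case by simp
next
  case (step B C)
  then show ?case using sigma_step_Int[OF assms(1,2) step.hyps(2)] by simp
qed

lemma normalizes_set_mult_left:
  assumes A: "subgroup A G" and C: "subgroup C G" and D: "subgroup D G" and "C \<subseteq> D"
    and AD: "normalizes D A" and DC: "normalizes D C"
  shows "normalizes (A <#> D) (A <#> C)"
  unfolding normalizes_def
proof (intro ballI)
  interpret A: subgroup A G by fact
  interpret C: subgroup C G by fact
  interpret D: subgroup D G by fact
  interpret AC: subgroup "A <#> C" G
    using subgroup_set_mult[OF A C] normalizes_imp_permutes_with[OF A C] normalizes_subset[OF AD] \<open>C \<subseteq> D\<close> by blast
  fix x y assume "x \<in> A <#> D" "y \<in> A <#> C"
  then obtain a d b c where x: "a \<in> A" "d \<in> D" "x = a \<otimes> d" and y: "b \<in> A" "c \<in> C" "y = b \<otimes> c"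
    by (auto simp: set_mult_def)
  have b': "d \<otimes> b \<otimes> inv d \<in> A" and c': "d \<otimes> c \<otimes> inv d \<in> C"
    using x y AD DC by (auto simp: normalizes_def)
  have aAC: "a \<in> A <#> C" using x subset_set_mult_left[OF A.subset C] by blast
  have "(d \<otimes> b \<otimes> inv d) \<otimes> (d \<otimes> c \<otimes> inv d) \<in> A <#> C"
    using b' c' unfolding set_mult_def by blast
  then have "a \<otimes> ((d \<otimes> b \<otimes> inv d) \<otimes> (d \<otimes> c \<otimes> inv d)) \<otimes> inv a \<in> A <#> C"
    using aAC AC.m_closed AC.m_inv_closed by blast
  moreover have "a \<otimes> ((d \<otimes> b \<otimes> inv d) \<otimes> (d \<otimes> c \<otimes> inv d)) \<otimes> inv a = x \<otimes> y \<otimes> inv x"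
    using x y by (simp add: m_assoc inv_mult_group inv_mult_cancel)
  ultimately show "x \<otimes> y \<otimes> inv x \<in> A <#> C" by simp
qed

text \<open>This is the image of a chain under reduction modulo \<open>A\<close>, pulled back to \<open>G\<close>. In the second case
  \<open>AD = (AN)D\<close> has index over \<open>AN\<close> equal to \<open>|D : AN \<inter> D|\<close>, a divisor of \<open>|D : N|\<close>.\<close>

lemma sigma_step_set_mult:
  assumes fin: "finite (carrier G)" and A: "subgroup A G" and n: "normalizes R A" and "D \<subseteq> R"
    and st: "sigma_step \<sigma> C D"
  shows "sigma_step \<sigma> (A <#> C) (A <#> D)"
proof -
  have C: "subgroup C G" and D: "subgroup D G" and CD: "C \<subseteq> D"
    using st by (auto simp: sigma_step_def)
  have nD: "normalizes D A" using n \<open>D \<subseteq> R\<close> by (rule normalizes_subset)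
  have sub: "subgroup (A <#> E) G" if E: "subgroup E G" "E \<subseteq> D" for E
    using subgroup_set_mult[OF A E(1)] normalizes_imp_permutes_with[OF A E(1)] normalizes_subset[OF nD E(2)] by blast
  have mono: "A <#> E \<subseteq> A <#> F" if "E \<subseteq> F" for E F
    using that unfolding set_mult_def by blast
  consider "normalizes D C"
    | \<pi> N where "\<pi> \<in> \<sigma>" "subgroup N G" "N \<subseteq> C" "normalizes D N" "pi_index \<pi> N D"
    using st by (auto simp: sigma_step_def)
  then show ?thesis
  proof cases
    case 1
    then show ?thesis
      using normalizes_set_mult_left[OF A C D CD nD] sub C D CD mono by (simp add: sigma_step_def)
  next
    case 2
    have ND: "N \<subseteq> D" using 2(3) CD by blast
    have S: "subgroup ((A <#> N) \<inter> D) G" using sub[OF 2(2) ND] D subgroups_Inter_pair by blast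
    have "N \<subseteq> A <#> N" using subset_set_mult_right[OF _ A] 2(2) subgroup.subset by blast
    then have "pi_index \<pi> ((A <#> N) \<inter> D) D"
      using pi_index_between(2)[OF fin 2(2) D S] ND 2(5) by blast
    then have "pi_index \<pi> (A <#> N) ((A <#> N) <#> D)" by (rule pi_index_set_mult[OF fin sub[OF 2(2) ND] D])
    moreover have "N <#> D = D"
    proof
      show "N <#> D \<subseteq> D" using set_mult_subset_subgroup[OF D ND] by blast
      show "D \<subseteq> N <#> D" using subset_set_mult_right[OF _ 2(2)] subgroup.subset[OF D] by blast
    qed
    ultimately have "pi_index \<pi> (A <#> N) (A <#> D)"
      using set_mult_assoc A 2(2) D subgroup.subset by metis
    then show ?thesis
      using normalizes_set_mult_left[OF A 2(2) D ND nD 2(4)] sub[OF C CD] sub[OF D order_refl]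
        sub[OF 2(2) ND] mono[OF CD] mono[OF 2(3)] 2(1)
      unfolding sigma_step_def by blast
  qed
qed

lemma sigma_sn_set_mult:
  assumes "finite (carrier G)" and "subgroup A G" and "normalizes R A" and "sigma_sn \<sigma> B R"
  shows "sigma_sn \<sigma> (A <#> B) (A <#> R)"
  using assms(4)
proof (induction rule: converse_rtranclp_induct)
  case base
  then show ?case by simp
next
  case (step B C)
  then show ?case
    using sigma_step_set_mult[OF assms(1,2,3) sigma_sn_subset[OF step.hyps(2)] step.hyps(1)] by simp
qed

section \<open>Residuals\<close>

text \<open>\<open>|Q : N \<inter> Q| = |NQ : N|\<close> divides both the order of \<open>Q\<close>, a
  \<open>\<pi>'\<close>-number, and the index of \<open>N\<close>, a \<open>\<pi>\<close>-number.\<close>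

lemma pi'_subgroup_subset_normal:
  assumes fin: "finite (carrier G)" and B: "subgroup B G" and N: "subgroup N G" and NB: "N \<subseteq> B"
    and n: "normalizes B N" and ind: "pi_index \<pi> N B"
    and Q: "subgroup Q G" "Q \<subseteq> B" "pi_number (- \<pi>) (card Q)"
  shows "Q \<subseteq> N"
proof -
  have S: "subgroup (N <#> Q) G"
    using subgroup_set_mult[OF N Q(1)] normalizes_imp_permutes_with[OF N Q(1)] normalizes_subset[OF n Q(2)] by blast
  have "N \<subseteq> N <#> Q" using subset_set_mult_left Q(1) N subgroup.subset by blast
  moreover have "N <#> Q \<subseteq> B" using set_mult_subset_subgroup[OF B NB Q(2)] .
  ultimately have "pi_index \<pi> N (N <#> Q)" using pi_index_between(1)[OF fin N B S] ind by blast
  then have 1: "pi_index \<pi> (N \<inter> Q) Q" by (rule pi_index_Int[OF fin N Q(1)])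
  have "card (N \<inter> Q) dvd card Q" using subgroup_card_dvd subgroups_Inter_pair N Q(1) by simp
  then obtain m where "card Q = card (N \<inter> Q) * m" by blast
  then have "pi_index (- \<pi>) (N \<inter> Q) Q"
    using pi_number_dvd[OF Q(3)] unfolding pi_index_def by (metis dvd_triv_right)
  then have "N \<inter> Q = Q" using pi_index_disjoint[OF fin Q(1) _ 1] by blast
  then show ?thesis by blast
qed

text \<open>Descending the chain, each step is either normal or of \<open>\<rho>\<close>-index over a normal subgroup. For
  \<open>\<rho> = \<pi>\<close> the normal case applies to that subgroup; for \<open>\<rho> \<noteq> \<pi>\<close> the index of the step is both a
  \<open>\<pi>\<close>- and a \<open>\<rho>\<close>-number, so the step is trivial.\<close>

lemma pi'_subgroup_subset_sigma_sn:
  assumes fin: "finite (carrier G)" and disj: "pairwise disjnt \<sigma>" and \<pi>: "\<pi> \<in> \<sigma>"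
    and sn: "sigma_sn \<sigma> A X" and X: "subgroup X G" and ind: "pi_index \<pi> A X"
    and Q: "subgroup Q G" "Q \<subseteq> X" "pi_number (- \<pi>) (card Q)"
  shows "Q \<subseteq> A"
  using sn ind
proof (induction rule: converse_rtranclp_induct)
  case base
  then show ?case using Q by simp
next
  case (step A B)
  have A: "subgroup A G" and B: "subgroup B G" and AB: "A \<subseteq> B"
    using step.hyps(1) by (auto simp: sigma_step_def)
  have BX: "B \<subseteq> X" using sigma_sn_subset[OF step.hyps(2)] .
  have indA: "pi_index \<pi> A B" and indB: "pi_index \<pi> B X"
    using pi_index_between[OF fin A X B AB BX step.prems] by auto
  have QB: "Q \<subseteq> B" using step.IH[OF indB] .
  consider "normalizes B A"
    | \<rho> N where "\<rho> \<in> \<sigma>" "subgroup N G" "N \<subseteq> A" "normalizes B N" "pi_index \<rho> N B"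
    using step.hyps(1) by (auto simp: sigma_step_def)
  then show ?case
  proof cases
    case 1
    then show ?thesis using pi'_subgroup_subset_normal[OF fin B A AB _ indA Q(1) QB Q(3)] by blast
  next
    case 2
    have NB: "N \<subseteq> B" using 2(3) AB by blast
    show ?thesis
    proof (cases "\<rho> = \<pi>")
      case True
      then show ?thesis
        using pi'_subgroup_subset_normal[OF fin B 2(2) NB 2(4) _ Q(1) QB Q(3)] 2(3,5) by blast
    next
      case False
      then have "\<pi> \<inter> \<rho> = {}" using disj \<pi> 2(1) by (auto simp: pairwise_def disjnt_def)
      moreover have "pi_index \<rho> A B" using pi_index_between(2)[OF fin 2(2) B A 2(3) AB 2(5)] .
      ultimately have "A = B" using pi_index_disjoint[OF fin B AB indA] by blast
      then show ?thesis using QB by simp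
    qed
  qed
qed

lemma pi_residual_subgroup: "subgroup (pi_residual \<pi> A) G"
  unfolding pi_residual_def by (intro generate_is_subgroup) (auto dest: subgroup.subset)

lemma pi_residual_subset: "subgroup A G \<Longrightarrow> pi_residual \<pi> A \<subseteq> A"
  unfolding pi_residual_def by (intro generate_subgroup_incl) auto

lemma normalizes_generate_invariant:
  assumes A: "subgroup A G" and U: "U \<subseteq> A" and inv: "\<And>a u. a \<in> A \<Longrightarrow> u \<in> U \<Longrightarrow> a \<otimes> u \<otimes> inv a \<in> U"
  shows "normalizes A (generate G U)"
proof -
  interpret A: group "G\<lparr>carrier := A\<rparr>" using A by (rule subgroup_imp_group)
  have "generate (G\<lparr>carrier := A\<rparr>) U \<lhd> G\<lparr>carrier := A\<rparr>"
    using U inv by (intro A.normal_generateI) (auto simp: m_inv_consistent[OF A])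
  then have "generate G U \<lhd> G\<lparr>carrier := A\<rparr>" by (simp add: generate_consistent[OF U A])
  then show ?thesis
    using A.normal_invE(2) by (fastforce simp: normalizes_def m_inv_consistent[OF A])
qed

lemma normalizes_pi_residual:
  assumes A: "subgroup A G"
  shows "normalizes A (pi_residual \<pi> A)"
  unfolding pi_residual_def
proof (rule normalizes_generate_invariant[OF A])
  show "\<Union>{Q. subgroup Q G \<and> Q \<subseteq> A \<and> pi_number (- \<pi>) (card Q)} \<subseteq> A" by blast
  fix a u assume a: "a \<in> A" and "u \<in> \<Union>{Q. subgroup Q G \<and> Q \<subseteq> A \<and> pi_number (- \<pi>) (card Q)}"
  then obtain Q where Q: "subgroup Q G" "Q \<subseteq> A" "pi_number (- \<pi>) (card Q)" "u \<in> Q" by blast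
  have ac: "a \<in> carrier G" using a A subgroup.mem_carrier by metis
  have "subgroup (conjugate a Q) G" using conjugate_subgroup ac Q(1) by blast
  moreover have "conjugate a Q \<subseteq> A"
    using normalizes_self[OF A] a Q(2) by (auto simp: conjugate_def normalizes_def)
  moreover have "card (conjugate a Q) = card Q" using card_conjugate[OF ac] Q(1) subgroup.subset by blast
  moreover have "a \<otimes> u \<otimes> inv a \<in> conjugate a Q" using Q(4) by (auto simp: conjugate_def)
  ultimately show "a \<otimes> u \<otimes> inv a \<in> \<Union>{Q. subgroup Q G \<and> Q \<subseteq> A \<and> pi_number (- \<pi>) (card Q)}"
    using Q(3) by auto
qed

lemma sylow_subgroup:
  assumes fin: "finite (carrier G)" and A: "subgroup A G" and p: "Factorial_Ring.prime p"
  obtains S where "subgroup S G" "S \<subseteq> A" "card S = p ^ multiplicity p (card A)"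
proof -
  have "card A \<noteq> 0" using subgroup_card_pos[OF fin A] by simp
  then obtain m where "card A = p ^ multiplicity p (card A) * m"
    using multiplicity_dvd[of p "card A"] by (auto elim: dvdE)
  then obtain S where S: "subgroup S (G\<lparr>carrier := A\<rparr>)" "card S = p ^ multiplicity p (card A)"
    using sylow_thm[OF p subgroup_imp_group[OF A], of "multiplicity p (card A)" m] subgroup_finite[OF fin A]
    by (auto simp: order_def)
  then show ?thesis using that[of S] incl_subgroup[OF A S(1)] subgroup.subset[OF S(1)] by simp
qed

text \<open>For a prime \<open>p\<close> outside \<open>\<pi>\<close>, the residual contains a Sylow \<open>p\<close>-subgroup of \<open>A\<close>, so \<open>p\<close> does not
  divide its index.\<close>

lemma pi_index_pi_residual:
  assumes fin: "finite (carrier G)" and A: "subgroup A G"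
  shows "pi_index \<pi> (pi_residual \<pi> A) A"
proof -
  let ?O = "pi_residual \<pi> A"
  obtain m where m: "card A = card ?O * m"
    using subgroup_card_dvd[OF pi_residual_subgroup A pi_residual_subset[OF A]] by (auto elim: dvdE)
  have "p \<in> \<pi>" if p: "Factorial_Ring.prime p" "p dvd m" for p
  proof (rule ccontr)
    assume np: "p \<notin> \<pi>"
    obtain S where S: "subgroup S G" "S \<subseteq> A" "card S = p ^ multiplicity p (card A)"
      using sylow_subgroup[OF fin A p(1)] .
    have "pi_number (- \<pi>) (card S)"
      unfolding pi_number_def S(3) using np p(1) by (metis ComplI prime_dvd_power primes_dvd_imp_eq)
    then have "S \<subseteq> ?O" unfolding pi_residual_def using S(1,2) by (blast intro: generate.incl)
    then have "p ^ multiplicity p (card A) dvd card ?O"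
      using subgroup_card_dvd[OF S(1) pi_residual_subgroup] S(3) by simp
    then have "p ^ Suc (multiplicity p (card A)) dvd card A"
      unfolding m using p(2) by (simp add: mult.commute mult_dvd_mono)
    moreover have "card A \<noteq> 0" using subgroup_card_pos[OF fin A] by simp
    ultimately show False using p(1)
      by (metis multiplicity_geI not_less_eq_eq order_refl not_prime_unit)
  qed
  then show ?thesis using m unfolding pi_index_def pi_number_def by blast
qed

lemma pi_residual_eq:
  assumes fin: "finite (carrier G)" and "pairwise disjnt \<sigma>" and "\<pi> \<in> \<sigma>"
    and "sigma_sn \<sigma> A X" and X: "subgroup X G" and "pi_index \<pi> A X"
  shows "pi_residual \<pi> A = pi_residual \<pi> X"
proof -
  have "A \<subseteq> X" using sigma_sn_subset assms(4) .
  then have "{Q. subgroup Q G \<and> Q \<subseteq> A \<and> pi_number (- \<pi>) (card Q)} =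
      {Q. subgroup Q G \<and> Q \<subseteq> X \<and> pi_number (- \<pi>) (card Q)}"
    using pi'_subgroup_subset_sigma_sn[OF assms] by blast
  then show ?thesis by (simp add: pi_residual_def)
qed

section \<open>Permuting subgroups\<close>

lemma pi_index_set_mult_pi_group:
  assumes fin: "finite (carrier G)" and H: "subgroup H G" and Q: "subgroup Q G" "pi_number \<pi> (card Q)"
  shows "pi_index \<pi> H (H <#> Q)"
proof (rule pi_index_set_mult[OF fin H Q(1)])
  obtain m where "card Q = card (H \<inter> Q) * m"
    using subgroup_card_dvd[OF subgroups_Inter_pair[OF H Q(1)] Q(1)] by (auto elim: dvdE)
  then show "pi_index \<pi> (H \<inter> Q) Q"
    using pi_number_dvd[OF Q(2)] unfolding pi_index_def by (metis dvd_triv_right)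
qed

text \<open>The join of the conjugates of \<open>H\<close> under \<open>P\<close> lies in the subgroup \<open>HP\<close>, and the index of
  \<open>H\<close> in \<open>HP\<close> divides the order of \<open>P\<close>. This is how a larger permuting subgroup with controlled
  index over \<open>H\<close> is produced.\<close>

lemma conjugates_join:
  assumes fin: "finite (carrier G)" and H: "subgroup H G" and P: "subgroup P G"
    and card: "pi_number \<pi> (card P)" and perm: "permutes_with H P"
  defines "K \<equiv> generate G (\<Union>p\<in>P. conjugate p H)"
  shows "subgroup K G" and "H \<subseteq> K" and "pi_index \<pi> H K"
proof -
  have Hc: "H \<subseteq> carrier G" and Pc: "P \<subseteq> carrier G" using H P subgroup.subset by auto
  show K: "subgroup K G"
    unfolding K_def using Pc subgroup.subset[OF conjugate_subgroup[OF _ H]]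
    by (intro generate_is_subgroup) blast
  have "conjugate \<one> H = H" using Hc by (force simp: conjugate_def)
  then show HK: "H \<subseteq> K"
    unfolding K_def using subgroup.one_closed[OF P] by (blast intro: generate.incl)
  have HP: "subgroup (H <#> P) G" using subgroup_set_mult[OF H P perm] .
  have "K \<subseteq> H <#> P"
    unfolding K_def
  proof (rule generate_subgroup_incl[OF _ HP])
    have "h \<in> H <#> P" if "h \<in> H" for h using that subset_set_mult_left[OF Hc P] by blast
    moreover have "p \<in> H <#> P" if "p \<in> P" for p using that subset_set_mult_right[OF Pc H] by blast
    ultimately show "(\<Union>p\<in>P. conjugate p H) \<subseteq> H <#> P"
      using HP by (auto simp: conjugate_def subgroup.m_closed subgroup.m_inv_closed)
  qed
  then show "pi_index \<pi> H K"
    using pi_index_between(1)[OF fin H HP K HK] pi_index_set_mult_pi_group[OF fin H P card] by blast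
qed

text \<open>The pivotal observation. The index of \<open>H\<close> in \<open>K \<inter> HQ\<close> is both a \<open>\<pi>\<close>-number (look at \<open>K\<close>)
  and a \<open>\<rho>\<close>-number (look at \<open>HQ\<close>), so \<open>H = K \<inter> HQ\<close>. Hence \<open>H\<close> inherits \<open>\<sigma>\<close>-subnormality in \<open>HQ\<close>
  from \<open>K\<close>, and being of \<open>\<rho>\<close>-index there it has the same \<open>\<rho>\<close>-residual as \<open>HQ\<close>, which is normal
  in \<open>HQ\<close>.\<close>

lemma normalizes_pi_residual_of_permutes_with:
  assumes fin: "finite (carrier G)" and disj: "pairwise disjnt \<sigma>"
    and \<pi>: "\<pi> \<in> \<sigma>" and \<rho>: "\<rho> \<in> \<sigma>" and ne: "\<pi> \<noteq> \<rho>"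
    and H: "subgroup H G" and K: "subgroup K G" "H \<subseteq> K" "sigma_sn \<sigma> K (carrier G)" "pi_index \<pi> H K"
    and Q: "subgroup Q G" "pi_number \<rho> (card Q)" and perm: "permutes_with H Q"
  shows "normalizes Q (pi_residual \<rho> H)"
proof -
  let ?X = "H <#> Q"
  have X: "subgroup ?X G" using subgroup_set_mult[OF H Q(1) perm] .
  have HX: "H \<subseteq> ?X" using subset_set_mult_left Q(1) H subgroup.subset by blast
  have KX: "subgroup (K \<inter> ?X) G" using subgroups_Inter_pair K(1) X by blast
  have index: "pi_index \<rho> H ?X" using pi_index_set_mult_pi_group[OF fin H Q] .
  have "pi_index \<pi> H (K \<inter> ?X)" using pi_index_between(1)[OF fin H K(1) KX _ _ K(4)] K(2) HX by blast
  moreover have "pi_index \<rho> H (K \<inter> ?X)"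
    using pi_index_between(1)[OF fin H X KX _ _ index] K(2) HX by blast
  moreover have "\<pi> \<inter> \<rho> = {}" using disj \<pi> \<rho> ne by (auto simp: pairwise_def disjnt_def)
  ultimately have "H = K \<inter> ?X" using pi_index_disjoint[OF fin KX] K(2) HX by blast
  moreover have "carrier G \<inter> ?X = ?X" using subgroup.subset[OF X] by blast
  ultimately have "sigma_sn \<sigma> H ?X" using sigma_sn_Int[OF fin X K(3)] by simp
  then have "pi_residual \<rho> H = pi_residual \<rho> ?X"
    using pi_residual_eq[OF fin disj \<rho> _ X index] by blast
  moreover have "Q \<subseteq> ?X" using subset_set_mult_right H Q(1) subgroup.subset by blast
  ultimately show ?thesis using normalizes_subset[OF normalizes_pi_residual[OF X]] by simp
qed

text \<open>The projectors enter only through a family \<open>\<Q> \<pi>\<close> of \<open>\<pi>\<close>-subgroups that is closed under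
  conjugation and generates a subgroup of \<open>\<pi>'\<close>-index. The induction goes up from \<open>H\<close> to larger
  permuting subgroups inside the fixed group \<open>G\<close>, with products \<open>HN\<close> in the role that quotients by
  \<open>N\<close> usually have; so all groups share one type of elements.\<close>

theorem sigma_sn_of_permutes_with:
  assumes fin: "finite (carrier G)"
    and disj: "pairwise disjnt \<sigma>" and cover: "\<And>p. Factorial_Ring.prime p \<Longrightarrow> \<exists>\<pi>\<in>\<sigma>. p \<in> \<pi>"
    and Q: "\<And>\<pi> Q. \<pi> \<in> \<sigma> \<Longrightarrow> Q \<in> \<Q> \<pi> \<Longrightarrow> subgroup Q G \<and> pi_number \<pi> (card Q)"
    and conj: "\<And>\<pi> Q g. \<pi> \<in> \<sigma> \<Longrightarrow> Q \<in> \<Q> \<pi> \<Longrightarrow> g \<in> carrier G \<Longrightarrow> conjugate g Q \<in> \<Q> \<pi>"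
    and full: "\<And>\<pi>. \<pi> \<in> \<sigma> \<Longrightarrow> pi_index (- \<pi>) (generate G (\<Union>(\<Q> \<pi>))) (carrier G)"
    and "subgroup H G" and "\<And>\<pi> Q. \<pi> \<in> \<sigma> \<Longrightarrow> Q \<in> \<Q> \<pi> \<Longrightarrow> permutes_with H Q"
  shows "sigma_sn \<sigma> H (carrier G)"
  using assms(7,8)
proof (induction "card (carrier G) - card H" arbitrary: H rule: less_induct)
  case less
  note H = less.prems(1) and perm = less.prems(2)
  note Gs = subgroup_self
  have Hc: "H \<subseteq> carrier G" using H subgroup.subset by blast
  have Qs: "subgroup Q G" and Qpi: "pi_number \<pi> (card Q)" and Qc: "Q \<subseteq> carrier G"
    if "\<pi> \<in> \<sigma>" "Q \<in> \<Q> \<pi>" for \<pi> Q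
    using Q[OF that] subgroup.subset by blast+
  have IH: "sigma_sn \<sigma> K (carrier G)"
    if K: "subgroup K G" and "H \<subseteq> K" and "H \<noteq> K"
      and p: "\<And>\<pi> Q. \<pi> \<in> \<sigma> \<Longrightarrow> Q \<in> \<Q> \<pi> \<Longrightarrow> permutes_with K Q" for K
  proof (rule less.hyps[OF _ K p])
    have "card H < card K" using psubset_card_mono[OF subgroup_finite[OF fin K]] that(2,3) by blast
    moreover have "card K \<le> card (carrier G)" using card_mono[OF fin] subgroup.subset[OF K] by blast
    ultimately show "card (carrier G) - card K < card (carrier G) - card H" by linarith
  qed
  define normal_closure where "normal_closure = (\<lambda>\<S>. generate G (\<Union>\<pi>\<in>\<S>. \<Union>(\<Q> \<pi>)))"
  have inv: "g \<otimes> u \<otimes> inv g \<in> (\<Union>\<pi>\<in>\<S>. \<Union>(\<Q> \<pi>))"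
    if S: "\<S> \<subseteq> \<sigma>" "g \<in> carrier G" "u \<in> (\<Union>\<pi>\<in>\<S>. \<Union>(\<Q> \<pi>))" for \<S> g u
  proof -
    obtain \<pi> Q where "\<pi> \<in> \<S>" "Q \<in> \<Q> \<pi>" "u \<in> Q" using S(3) by blast
    then show ?thesis
      using conj[of \<pi> Q g] S(1,2) unfolding conjugate_def by blast
  qed
  have cl_in: "(\<Union>\<pi>\<in>\<S>. \<Union>(\<Q> \<pi>)) \<subseteq> carrier G" if "\<S> \<subseteq> \<sigma>" for \<S>
    using that Qc by blast
  have cl_sub: "subgroup (normal_closure \<S>) G" if "\<S> \<subseteq> \<sigma>" for \<S>
    unfolding normal_closure_def using generate_is_subgroup cl_in[OF that] .
  have cl_normal: "normalizes (carrier G) (normal_closure \<S>)" if "\<S> \<subseteq> \<sigma>" for \<S>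
    unfolding normal_closure_def using normalizes_generate_invariant[OF Gs cl_in[OF that]] inv[OF that] by blast
  have cl_normalizes: "normalizes (normal_closure \<S>) A"
    if S: "\<S> \<subseteq> \<sigma>" and A: "subgroup A G" and n: "\<And>\<pi> Q. \<pi> \<in> \<S> \<Longrightarrow> Q \<in> \<Q> \<pi> \<Longrightarrow> normalizes Q A" for \<S> A
  proof -
    have "normalizes (generate G (\<Union>(\<Union>\<pi>\<in>\<S>. \<Q> \<pi>))) A"
      using S n Qs subgroup.subset[OF A] by (intro normalizes_generate) auto
    moreover have "\<Union>(\<Union>\<pi>\<in>\<S>. \<Q> \<pi>) = (\<Union>\<pi>\<in>\<S>. \<Union>(\<Q> \<pi>))" by blast
    ultimately show ?thesis by (simp add: normal_closure_def)
  qed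
  have Hcl: "subgroup (H <#> normal_closure \<S>) G" "H \<subseteq> H <#> normal_closure \<S>" "normal_closure \<S> \<subseteq> H <#> normal_closure \<S>"
    if "\<S> \<subseteq> \<sigma>" for \<S>
  proof -
    note cs = cl_sub[OF that]
    have "permutes_with (normal_closure \<S>) H"
      using normalizes_imp_permutes_with[OF cs H] normalizes_subset[OF cl_normal[OF that] Hc] by blast
    then show "subgroup (H <#> normal_closure \<S>) G"
      using subgroup_set_mult[OF H cs] permutes_with_sym[OF cs H] by blast
    show "H \<subseteq> H <#> normal_closure \<S>" using subset_set_mult_left[OF Hc cs] .
    show "normal_closure \<S> \<subseteq> H <#> normal_closure \<S>" using subset_set_mult_right[OF _ H] cs subgroup.subset by blast
  qed
  show ?case
  proof (cases "\<exists>\<pi>\<in>\<sigma>. \<forall>\<rho>\<in>\<sigma> - {\<pi>}. \<forall>Q\<in>\<Q> \<rho>. normalizes Q H")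
    case True
    then obtain \<pi> where \<pi>: "\<pi> \<in> \<sigma>" and n: "\<forall>\<rho>\<in>\<sigma> - {\<pi>}. \<forall>Q\<in>\<Q> \<rho>. normalizes Q H" by blast
    \<comment> \<open>Here \<open>H \<lhd> HL\<close>, and \<open>HL\<close> contains the normal subgroup \<open>L\<close> of \<open>\<pi>\<close>-index: two steps suffice.\<close>
    let ?L = "normal_closure (\<sigma> - {\<pi>})"
    have S: "\<sigma> - {\<pi>} \<subseteq> \<sigma>" by blast
    have "normalizes ?L H" using cl_normalizes[OF S H] n by blast
    then have "normalizes (H <#> ?L) H"
      using normalizes_set_mult[OF normalizes_self[OF H] _ Hc Hc] cl_sub[OF S] subgroup.subset by blast
    then have 1: "sigma_step \<sigma> H (H <#> ?L)" using H Hcl[OF S] by (simp add: sigma_step_def)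
    obtain m where m: "card (carrier G) = card ?L * m"
      using subgroup_card_dvd[OF cl_sub[OF S] Gs] subgroup.subset[OF cl_sub[OF S]] by (auto elim: dvdE)
    have "p \<in> \<pi>" if p: "Factorial_Ring.prime p" "p dvd m" for p
    proof (rule ccontr)
      assume "p \<notin> \<pi>"
      then obtain \<rho> where \<rho>: "\<rho> \<in> \<sigma>" "p \<in> \<rho>" "\<rho> \<noteq> \<pi>" using cover[OF p(1)] by blast
      let ?M = "generate G (\<Union>(\<Q> \<rho>))"
      have M: "subgroup ?M G" using generate_is_subgroup Qc[OF \<rho>(1)] by blast
      have "?M \<subseteq> ?L" unfolding normal_closure_def using \<rho> by (intro mono_generate) blast
      then have "pi_index (- \<rho>) ?L (carrier G)"
        using pi_index_between(2)[OF fin M Gs cl_sub[OF S]] full[OF \<rho>(1)] subgroup.subset[OF cl_sub[OF S]] by blast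
      then obtain k where "card (carrier G) = card ?L * k" "pi_number (- \<rho>) k" by (auto simp: pi_index_def)
      then have "pi_number (- \<rho>) m" using m subgroup_card_pos[OF fin cl_sub[OF S]] by simp
      then show False using p \<rho>(2) by (auto simp: pi_number_def)
    qed
    then have "pi_index \<pi> ?L (carrier G)" using m by (auto simp: pi_index_def pi_number_def)
    then have 2: "sigma_step \<sigma> (H <#> ?L) (carrier G)"
      using \<pi> Hcl[OF S] Gs cl_sub[OF S] cl_normal[OF S] subgroup.subset[OF Hcl(1)[OF S]]
      unfolding sigma_step_def by blast
    show ?thesis using 1 2 by (meson r_into_rtranclp rtranclp.rtrancl_into_rtrancl)
  next
    case False
    \<comment> \<open>A member \<open>P\<close> of one family that does not normalize \<open>H\<close> makes all other families normalize residuals.\<close>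
    have residual_normalized: "normalizes Q (pi_residual \<rho> H)"
      if \<pi>: "\<pi> \<in> \<sigma>" "P \<in> \<Q> \<pi>" "\<not> normalizes P H" and \<rho>: "\<rho> \<in> \<sigma>" "\<rho> \<noteq> \<pi>" "Q \<in> \<Q> \<rho>" for \<pi> \<rho> P Q
    proof -
      note P = Qs[OF \<pi>(1,2)] and Pc = Qc[OF \<pi>(1,2)]
      let ?K = "generate G (\<Union>p\<in>P. conjugate p H)"
      note K = conjugates_join[OF fin H P Qpi[OF \<pi>(1,2)] perm[OF \<pi>(1,2)]]
      have "\<exists>p\<in>P. \<not> conjugate p H \<subseteq> H" using \<pi>(3) by (auto simp: normalizes_def conjugate_def)
      then have "H \<noteq> ?K" using generate.incl[of _ "\<Union>p\<in>P. conjugate p H" G] by blast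
      moreover have "permutes_with ?K R" if R: "\<tau> \<in> \<sigma>" "R \<in> \<Q> \<tau>" for \<tau> R
      proof (rule permutes_with_generate[OF Qs[OF R]])
        fix A assume "A \<in> (\<lambda>p. conjugate p H) ` P"
        then obtain p where p: "p \<in> carrier G" "A = conjugate p H" using Pc by blast
        show "subgroup A G" using p conjugate_subgroup H by blast
        show "permutes_with A R"
          using p permutes_with_conjugate[OF _ H Qs[OF R]] perm[OF R(1) conj[OF R]] by blast
      qed
      ultimately have "sigma_sn \<sigma> ?K (carrier G)" using IH[OF K(1,2)] by blast
      then show ?thesis
        using normalizes_pi_residual_of_permutes_with[OF fin disj \<pi>(1) \<rho>(1) _ H K(1,2) _ K(3)
            Qs[OF \<rho>(1,3)] Qpi[OF \<rho>(1,3)] perm[OF \<rho>(1,3)]] \<rho>(2) by blast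
    qed
    have ex: "\<exists>\<rho>\<in>\<sigma>. \<rho> \<noteq> \<pi> \<and> (\<exists>Q\<in>\<Q> \<rho>. \<not> normalizes Q H)" if "\<pi> \<in> \<sigma>" for \<pi>
      using False that by blast
    \<comment> \<open>The prime 2 shows that \<open>\<sigma>\<close> is nonempty; by assumption no class accounts for all failures, so two distinct ones have members not normalizing \<open>H\<close>.\<close>
    obtain \<pi>0 where "\<pi>0 \<in> \<sigma>" using cover[OF two_is_prime_nat] by blast
    then obtain \<pi> P where \<pi>: "\<pi> \<in> \<sigma>" "P \<in> \<Q> \<pi>" "\<not> normalizes P H" using ex by blast
    obtain \<rho> Q where \<rho>: "\<rho> \<in> \<sigma>" "\<rho> \<noteq> \<pi>" "Q \<in> \<Q> \<rho>" "\<not> normalizes Q H" using ex[OF \<pi>(1)] by blast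
    \<comment> \<open>The other class \<open>\<upsilon>\<close> provides the normalized residual; \<open>\<tau>\<close> itself makes the product properly larger than \<open>H\<close>.\<close>
    have main: "sigma_sn \<sigma> (H <#> normal_closure {\<tau>}) (carrier G)"
        "normalizes (H <#> normal_closure {\<tau>}) (pi_residual \<tau> H)"
      if \<tau>: "\<tau> \<in> \<sigma>" "R \<in> \<Q> \<tau>" "\<not> normalizes R H" and \<upsilon>: "\<upsilon> \<in> \<sigma>" "\<upsilon> \<noteq> \<tau>" "U \<in> \<Q> \<upsilon>" "\<not> normalizes U H"
      for \<tau> R \<upsilon> U
    proof -
      have S: "{\<tau>} \<subseteq> \<sigma>" using \<tau>(1) by blast
      have "R \<subseteq> normal_closure {\<tau>}" unfolding normal_closure_def using \<tau>(2) by (auto intro: generate.incl)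
      then have "R \<subseteq> H <#> normal_closure {\<tau>}" using Hcl(3)[OF S] by blast
      then have "H \<noteq> H <#> normal_closure {\<tau>}"
        using \<tau>(3) normalizes_subset[OF normalizes_self[OF H]] by metis
      then show "sigma_sn \<sigma> (H <#> normal_closure {\<tau>}) (carrier G)"
        using IH[OF Hcl(1,2)[OF S]] permutes_with_set_mult_normal[OF H Qs cl_sub[OF S] perm cl_normal[OF S]]
        by blast
      have "normalizes (normal_closure {\<tau>}) (pi_residual \<tau> H)"
        using cl_normalizes[OF S pi_residual_subgroup] residual_normalized[OF \<upsilon>(1,3,4) \<tau>(1)] \<upsilon>(2) by blast
      then show "normalizes (H <#> normal_closure {\<tau>}) (pi_residual \<tau> H)"
        using normalizes_set_mult[OF normalizes_pi_residual[OF H]] Hc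
          subgroup.subset[OF cl_sub[OF S]] subgroup.subset[OF pi_residual_subgroup] by blast
    qed
    let ?A = "pi_residual \<pi> H" and ?B = "pi_residual \<rho> H"
    let ?R = "H <#> normal_closure {\<pi>}"
    have A: "subgroup ?A G" and B: "subgroup ?B G" using pi_residual_subgroup by auto
    have AH: "?A \<subseteq> H" and BH: "?B \<subseteq> H" using pi_residual_subset[OF H] by auto
    have R: "subgroup ?R G" and HR: "H \<subseteq> ?R" using Hcl \<pi>(1) by auto
    have "\<pi> \<noteq> \<rho>" using \<rho>(2) by blast
    note mA = main[OF \<pi> \<rho>] and mB = main[OF \<rho>(1,3,4) \<pi>(1) \<open>\<pi> \<noteq> \<rho>\<close> \<pi>(2,3)]
    \<comment> \<open>\<open>B\<close> is \<open>\<sigma>\<close>-subnormal in \<open>G\<close>, hence in \<open>R\<close>; multiplying the chain by \<open>A \<lhd> R\<close> turns \<open>B\<close> into \<open>AB = H\<close>.\<close>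
    have "sigma_step \<sigma> ?B (H <#> normal_closure {\<rho>})"
      using mB(2) B BH Hcl[of "{\<rho>}"] \<rho>(1) by (auto simp: sigma_step_def)
    then have "sigma_sn \<sigma> ?B (carrier G)" using mB(1) by (rule converse_rtranclp_into_rtranclp)
    then have "sigma_sn \<sigma> (?B \<inter> ?R) (carrier G \<inter> ?R)" by (rule sigma_sn_Int[OF fin R])
    moreover have "?B \<inter> ?R = ?B" "carrier G \<inter> ?R = ?R" using BH HR subgroup.subset[OF R] by auto
    ultimately have "sigma_sn \<sigma> ?B ?R" by simp
    then have sn: "sigma_sn \<sigma> (?A <#> ?B) (?A <#> ?R)" by (rule sigma_sn_set_mult[OF fin A mA(2)])
    have "?A <#> ?R = ?R"
    proof
      show "?A <#> ?R \<subseteq> ?R" using set_mult_subset_subgroup[OF R] AH HR by blast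
      show "?R \<subseteq> ?A <#> ?R" using subset_set_mult_right[OF subgroup.subset[OF R] A] .
    qed
    moreover have "?A <#> ?B = H"
    proof -
      have AB: "subgroup (?A <#> ?B) G"
        using subgroup_set_mult[OF A B] normalizes_imp_permutes_with[OF A B]
          normalizes_subset[OF normalizes_pi_residual[OF H] BH] by blast
      have sub: "?A <#> ?B \<subseteq> H" using set_mult_subset_subgroup[OF H AH BH] .
      have "?A \<subseteq> ?A <#> ?B" "?B \<subseteq> ?A <#> ?B"
        using subset_set_mult_left[OF subgroup.subset[OF A] B] subset_set_mult_right[OF subgroup.subset[OF B] A] by auto
      then have "pi_index \<pi> (?A <#> ?B) H" "pi_index \<rho> (?A <#> ?B) H"
        using pi_index_between(2)[OF fin A H AB _ sub] pi_index_between(2)[OF fin B H AB _ sub]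
          pi_index_pi_residual[OF fin H] by auto
      moreover have "\<pi> \<inter> \<rho> = {}" using disj \<pi>(1) \<rho>(1,2) by (auto simp: pairwise_def disjnt_def)
      ultimately show ?thesis using pi_index_disjoint[OF fin H sub] by blast
    qed
    ultimately have "sigma_sn \<sigma> H ?R" using sn by simp
    then show ?thesis using mA(1) by (rule rtranclp_trans)
  qed
qed

section \<open>Subnormality via cores\<close>

lemma normal_in_subgroup_iff:
  assumes B: "subgroup B G" and "A \<subseteq> B"
  shows "A \<lhd> G\<lparr>carrier := B\<rparr> \<longleftrightarrow> subgroup A G \<and> normalizes B A"
proof -
  interpret B: group "G\<lparr>carrier := B\<rparr>" using B by (rule subgroup_imp_group)
  have "subgroup A (G\<lparr>carrier := B\<rparr>) \<longleftrightarrow> subgroup A G"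
    using incl_subgroup[OF B] subgroup_incl[OF _ B \<open>A \<subseteq> B\<close>] by blast
  then show ?thesis
    by (simp add: B.normal_inv_iff normalizes_def m_inv_consistent[OF B])
qed

lemma order_Mod:
  assumes "N \<lhd> G"
  shows "order (G Mod N) * card N = order G"
  using lagrange normal_imp_subgroup[OF assms] by (simp add: FactGroup_def order_def)

lemma sigma_step_imp_normal_core:
  assumes fin: "finite (carrier G)" and st: "sigma_step \<sigma> A B"
  shows "A \<lhd> G\<lparr>carrier := B\<rparr> \<or>
    (\<exists>\<pi>\<in>\<sigma>. group_primes (G\<lparr>carrier := B\<rparr> Mod normal_core (G\<lparr>carrier := B\<rparr>) A) \<subseteq> \<pi>)"
proof -
  have A: "subgroup A G" and B: "subgroup B G" and AB: "A \<subseteq> B"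
    using st by (auto simp: sigma_step_def)
  interpret B: group "G\<lparr>carrier := B\<rparr>" using B by (rule subgroup_imp_group)
  let ?C = "normal_core (G\<lparr>carrier := B\<rparr>) A"
  have AB': "subgroup A (G\<lparr>carrier := B\<rparr>)" using subgroup_incl A B AB by blast
  note core = normal_core_greatest[OF B.is_group AB']
  consider "normalizes B A"
    | \<pi> N where "\<pi> \<in> \<sigma>" "subgroup N G" "N \<subseteq> A" "normalizes B N" "pi_index \<pi> N B"
    using st by (auto simp: sigma_step_def)
  then show ?thesis
  proof cases
    case 1
    then show ?thesis using normal_in_subgroup_iff[OF B AB] A by blast
  next
    case 2
    have "N \<lhd> G\<lparr>carrier := B\<rparr>" using normal_in_subgroup_iff[OF B] 2 AB by blast
    then have NC: "N \<subseteq> ?C" using core(3) 2(3) by blast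
    have C: "subgroup ?C G" and CB: "?C \<subseteq> B"
      using normal_in_subgroup_iff[OF B] core(1,2) AB by blast+
    obtain m where m: "card B = card ?C * m" "pi_number \<pi> m"
      using pi_index_between(2)[OF fin 2(2) B C NC CB 2(5)] by (auto simp: pi_index_def)
    have "order (G\<lparr>carrier := B\<rparr> Mod ?C) = m"
      using B.order_Mod[OF core(1)] m(1) subgroup_card_pos[OF fin C] by (simp add: order_def)
    then show ?thesis using m(2) 2(1) by (auto simp: group_primes_def pi_number_def)
  qed
qed

lemma sigma_sn_imp_sigma_subnormal:
  assumes fin: "finite (carrier G)" and H: "subgroup H G" and sn: "sigma_sn \<sigma> H (carrier G)"
  shows "sigma_subnormal \<sigma> G H"
proof -
  obtain n where "(sigma_step \<sigma> ^^ n) H (carrier G)" using sn by (auto simp: rtranclp_power)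
  then obtain C where C: "C 0 = H" "C n = carrier G" "\<forall>j<n. sigma_step \<sigma> (C j) (C (Suc j))"
    by (auto simp: relpowp_fun_conv)
  have "subgroup (C j) G" if "j \<le> n" for j
    using that C H subgroup_self by (cases "j = n") (auto simp: sigma_step_def)
  moreover have "C j \<subseteq> C (Suc j)" if "j < n" for j using C(3) that by (simp add: sigma_step_def)
  moreover note sigma_step_imp_normal_core[OF fin C(3)[rule_format]]
  ultimately show ?thesis
    unfolding sigma_subnormal_def using C(1,2) by (intro exI[of _ n] exI[of _ C]) simp
qed

section \<open>Projectors\<close>

text \<open>The projector condition for the trivial normal subgroup.\<close>

lemma pi_projector_pi_number:
  assumes P: "pi_projector \<pi> G P"
  shows "pi_number \<pi> (card P)"
proof -
  have sub: "subgroup P G" using P by (simp add: pi_projector_def)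
  interpret P: group "G\<lparr>carrier := P\<rparr>" using sub by (rule subgroup_imp_group)
  have "P <#> {\<one>} = P" using subgroup.subset[OF sub] by (force simp: set_mult_def)
  then have "pi_maximal \<pi> (G Mod {\<one>}) (carrier (G\<lparr>carrier := P\<rparr> Mod {\<one>}))"
    using P one_is_normal unfolding pi_projector_def by fastforce
  then have "group_primes ((G Mod {\<one>})\<lparr>carrier := carrier (G\<lparr>carrier := P\<rparr> Mod {\<one>})\<rparr>) \<subseteq> \<pi>"
    by (simp add: pi_maximal_def pi_subgroup_def pi_group_def)
  moreover have "order (G\<lparr>carrier := P\<rparr> Mod {\<one>}) = card P"
    using P.order_Mod[OF P.one_is_normal] by (simp add: order_def)
  ultimately show ?thesis by (auto simp: group_primes_def pi_number_def order_def)
qed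

text \<open>The projector condition for \<open>L\<close> says that the trivial group is a maximal \<open>\<pi>\<close>-subgroup of \<open>G / L\<close>,
  so \<open>G / L\<close> has trivial Sylow \<open>p\<close>-subgroups for all \<open>p \<in> \<pi>\<close>. It is applied to the normal closure
  of \<open>P\<close>.\<close>

lemma pi_projector_normal_index:
  assumes fin: "finite (carrier G)" and P: "pi_projector \<pi> G P" and L: "L \<lhd> G" and PL: "P \<subseteq> L"
  shows "pi_index (- \<pi>) L (carrier G)"
proof -
  have sub: "subgroup P G" using P by (simp add: pi_projector_def)
  have Ls: "subgroup L G" using L by (rule normal_imp_subgroup)
  interpret L: normal L G by fact
  interpret GL: group "G Mod L" by (rule L.factorgroup_is_group)
  interpret L': group "G\<lparr>carrier := L\<rparr>" using Ls by (rule subgroup_imp_group)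
  have m: "card (carrier G) = card L * order (G Mod L)"
    using order_Mod[OF L] by (simp add: order_def mult.commute)
  then have pos: "order (G Mod L) > 0"
    using subgroup_card_pos[OF fin subgroup_self] by (metis mult_0_right not_gr_zero)
  then have finGL: "finite (carrier (G Mod L))"
    by (simp add: order_def card_gt_0_iff)
  have "P <#> L \<subseteq> L" using set_mult_subset_subgroup[OF Ls PL] by blast
  moreover have "L \<subseteq> P <#> L" using subset_set_mult_right[OF L.subset sub] .
  ultimately have "P <#> L = L" by blast
  moreover have "carrier (G\<lparr>carrier := L\<rparr> Mod L) = {L}"
  proof -
    have "L #> x = L" if "x \<in> L" for x using coset_join2[OF _ Ls that] that L.subset by blast
    then have "(\<lambda>x. L #> x) ` L = {L}" using image_constant[OF L.one_closed, of L] by simp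
    then show ?thesis by (simp add: carrier_FactGroup r_coset_def)
  qed
  ultimately have max: "pi_maximal \<pi> (G Mod L) {L}"
    using P L unfolding pi_projector_def by metis
  have "p \<notin> \<pi>" if p: "Factorial_Ring.prime p" "p dvd order (G Mod L)" for p
  proof
    assume p\<pi>: "p \<in> \<pi>"
    let ?k = "multiplicity p (order (G Mod L))"
    obtain S where S: "subgroup S (G Mod L)" "card S = p ^ ?k"
      using GL.sylow_subgroup[OF finGL GL.subgroup_self p(1)] by (auto simp: order_def)
    have "group_primes ((G Mod L)\<lparr>carrier := S\<rparr>) \<subseteq> \<pi>"
    proof
      fix q assume "q \<in> group_primes ((G Mod L)\<lparr>carrier := S\<rparr>)"
      then have "Factorial_Ring.prime q" "q dvd p ^ ?k" using S(2) by (auto simp: group_primes_def order_def)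
      then have "q = p" using p(1) prime_dvd_power[of q p] primes_dvd_imp_eq[of q p] by blast
      then show "q \<in> \<pi>" using p\<pi> by simp
    qed
    then have "pi_subgroup \<pi> (G Mod L) S"
      using S(1) GL.subgroup_imp_group[OF S(1)] GL.subgroup_finite[OF finGL S(1)]
      by (simp add: pi_subgroup_def pi_group_def)
    moreover have "L \<in> S" using subgroup.one_closed[OF S(1)] by (simp add: FactGroup_def)
    ultimately have "S = {L}" using max by (auto simp: pi_maximal_def)
    then have "p ^ ?k = 1" using S(2) by simp
    moreover have "?k > 0" using p pos by (simp add: prime_multiplicity_gt_zero_iff)
    ultimately show False using p(1) by (auto dest: prime_gt_1_nat)
  qed
  then show ?thesis using m by (auto simp: pi_index_def pi_number_def)
qed

lemma conjugate_set_eq_conjugate: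
  assumes "x \<in> carrier G" and "P \<subseteq> carrier G"
  shows "conjugate_set G P x = conjugate (inv x) P"
  using assms by (auto simp: conjugate_set_def conjugate_def l_coset_def r_coset_def m_assoc subset_iff image_iff)

end

section \<open>Subgroups permuting with projectors\<close>

theorem corollary3:
  fixes G :: "('a, 'b) monoid_scheme"
    and I :: "'i set" and \<pi> :: "'i \<Rightarrow> nat set" and H :: "'a set"
  assumes "prime_partition I \<pi>"
    and "Group.group G" and "finite (carrier G)"
    and "sigma3_permutable (\<pi> ` I) G H"
  shows "sigma_subnormal (\<pi> ` I) G H"
proof -
  interpret group G by fact
  note fin = \<open>finite (carrier G)\<close>
  have H: "subgroup H G" using assms(4) by (simp add: sigma3_permutable_def)
  have "\<forall>\<rho>\<in>\<pi> ` I. \<exists>P. pi_projector \<rho> G P \<and>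
      (\<forall>x\<in>carrier G. H <#>\<^bsub>G\<^esub> conjugate_set G P x = conjugate_set G P x <#>\<^bsub>G\<^esub> H)"
    using assms(4) unfolding sigma3_permutable_def by blast
  then obtain P where P: "\<And>\<rho>. \<rho> \<in> \<pi> ` I \<Longrightarrow> pi_projector \<rho> G (P \<rho>)"
    and perm: "\<And>\<rho> x. \<rho> \<in> \<pi> ` I \<Longrightarrow> x \<in> carrier G \<Longrightarrow>
      H <#>\<^bsub>G\<^esub> conjugate_set G (P \<rho>) x = conjugate_set G (P \<rho>) x <#>\<^bsub>G\<^esub> H"
    by metis
  have Ps: "subgroup (P \<rho>) G" if "\<rho> \<in> \<pi> ` I" for \<rho> using P[OF that] by (simp add: pi_projector_def)
  have Pc: "P \<rho> \<subseteq> carrier G" if "\<rho> \<in> \<pi> ` I" for \<rho> using Ps[OF that] subgroup.subset by blast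
  define \<Q> where "\<Q> = (\<lambda>\<rho>. (\<lambda>x. conjugate x (P \<rho>)) ` carrier G)"
  have "sigma_sn (\<pi> ` I) H (carrier G)"
  proof (rule sigma_sn_of_permutes_with[OF fin _ _ _ _ _ H])
    show "pairwise disjnt (\<pi> ` I)"
    proof (rule pairwiseI)
      fix \<rho> \<tau> assume "\<rho> \<in> \<pi> ` I" "\<tau> \<in> \<pi> ` I" "\<rho> \<noteq> \<tau>"
      then obtain i j where "i \<in> I" "j \<in> I" "i \<noteq> j" "\<rho> = \<pi> i" "\<tau> = \<pi> j" by blast
      then show "disjnt \<rho> \<tau>"
        using assms(1) by (simp add: prime_partition_def disjoint_family_on_def disjnt_def)
    qed
    show "\<exists>\<rho>\<in>\<pi> ` I. p \<in> \<rho>" if "Factorial_Ring.prime p" for p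
      using assms(1) that unfolding prime_partition_def by blast
    fix \<rho> assume \<rho>: "\<rho> \<in> \<pi> ` I"
    show conj: "conjugate g Q \<in> \<Q> \<rho>" if Q: "Q \<in> \<Q> \<rho>" "g \<in> carrier G" for Q g
      using Q conjugate_conjugate[OF _ _ Pc[OF \<rho>]] by (auto simp: \<Q>_def)
    show sub: "subgroup Q G \<and> pi_number \<rho> (card Q)" if "Q \<in> \<Q> \<rho>" for Q
      using that conjugate_subgroup Ps[OF \<rho>] card_conjugate[OF _ Pc[OF \<rho>]]
        pi_projector_pi_number[OF P[OF \<rho>]] by (auto simp: \<Q>_def)
    show "permutes_with H Q" if Q: "Q \<in> \<Q> \<rho>" for Q
    proof -
      obtain x where x: "x \<in> carrier G" "Q = conjugate x (P \<rho>)" using Q by (auto simp: \<Q>_def)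
      then have "H <#>\<^bsub>G\<^esub> Q = Q <#>\<^bsub>G\<^esub> H"
        using perm[OF \<rho>, of "inv\<^bsub>G\<^esub> x"] conjugate_set_eq_conjugate[OF _ Pc[OF \<rho>]] by simp
      then show ?thesis unfolding permutes_with_def set_mult_def by blast
    qed
    let ?L = "generate G (\<Union>(\<Q> \<rho>))"
    have "\<Union>(\<Q> \<rho>) \<subseteq> carrier G" using sub subgroup.subset by blast
    then have "?L \<lhd> G"
    proof (rule normal_generateI)
      fix h g assume "h \<in> \<Union>(\<Q> \<rho>)" and g: "g \<in> carrier G"
      then obtain Q where "Q \<in> \<Q> \<rho>" "h \<in> Q" by blast
      then show "g \<otimes>\<^bsub>G\<^esub> h \<otimes>\<^bsub>G\<^esub> inv\<^bsub>G\<^esub> g \<in> \<Union>(\<Q> \<rho>)"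
        using conj[OF _ g] unfolding conjugate_def by blast
    qed
    moreover have "P \<rho> = conjugate \<one>\<^bsub>G\<^esub> (P \<rho>)" using Pc[OF \<rho>] by (force simp: conjugate_def)
    then have "P \<rho> \<in> \<Q> \<rho>" unfolding \<Q>_def by blast
    then have "P \<rho> \<subseteq> ?L" by (blast intro: generate.incl)
    ultimately show "pi_index (- \<rho>) ?L (carrier G)" using pi_projector_normal_index[OF fin P[OF \<rho>]] by blast
  qed
  then show ?thesis by (rule sigma_sn_imp_sigma_subnormal[OF fin H])
qed

end
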